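(* Let $q\in(0,1)$ and let $J_q(\,\cdot\,)=J_q(\,\cdot\,;a_{(J)},b)$ be any one of the three $q$-integrals $G_q(\,\cdot\,;bq^n,b)$, $I_q(\,\cdot\,;0,b)$, $R_q(\,\cdot\,;a,b)$ described in the context, with interval of integration $E_{(J)}=[a_{(J)},b]$. Let $f,g:E_{(J)}\to\mathbb{R}$ be two positive functions and $m<M$ real constants such that $$0<m\le\frac{g(x)}{f(x)}\le M<\infty\qquad\text{for all }x\in E_{(J)},$$ let $p\ne0$ be a real number, and assume that all $q$-integrals appearing below exist. Then, for $p\notin(0,1)$, $$J_q(f^{2-p}g^p)+\frac{mM(M^{p-1}-m^{p-1})}{M-m}J_q(f^2)\le\frac{M^p-m^p}{M-m}J_q(fg),$$ and for $p\in(0,1)$ the reverse inequality ($\ge$) holds. In particular, for $p=2$, $$J_q(g^2)+mM\,J_q(f^2)\le(M+m)\,J_q(fg).$$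
   Context: Let $q\in(0,1)$. The three types of $q$-integral are: (G) restricted $q$-integral: for $b>0$, a positive integer $n$ and $a=bq^n$, $G_q(h;a,b)=b(1-q)\sum_{k=0}^{n-1}h(bq^k)q^k$; here $a_{(J)}=bq^n$. (I) for $b>0$, $I_q(h;0,b)=b(1-q)\sum_{k=0}^{\infty}h(bq^k)q^k$; here $a_{(J)}=0$. (R) Riemann-type $q$-integral: for $0<a<b$, $R_q(h;a,b)=(b-a)(1-q)\sum_{k=0}^{\infty}h\bigl(a+(b-a)q^k\bigr)q^k$; here $a_{(J)}=a$. In each case $E_{(J)}=[a_{(J)},b]$. A $q$-integral of type (I) or (R) is said to exist if the defining series converges (type (G) always exists). "Positive" means strictly positive at every point of the domain. *)

theory Defs
  imports "HOL-Analysis.Analysis"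
begin

text \<open>
  The restricted integral is parametrised by \<open>n\<close> rather than by its lower end point,
  which is \<open>b * q ^ n\<close>.
\<close>

definition G_qint :: "real \<Rightarrow> nat \<Rightarrow> real \<Rightarrow> (real \<Rightarrow> real) \<Rightarrow> real" where
  "G_qint q n b h = b * (1 - q) * (\<Sum>k<n. h (b * q ^ k) * q ^ k)"

definition I_qint :: "real \<Rightarrow> real \<Rightarrow> (real \<Rightarrow> real) \<Rightarrow> real" where
  "I_qint q b h = b * (1 - q) * (\<Sum>k. h (b * q ^ k) * q ^ k)"

definition R_qint :: "real \<Rightarrow> real \<Rightarrow> real \<Rightarrow> (real \<Rightarrow> real) \<Rightarrow> real" where
  "R_qint q a b h = (b - a) * (1 - q) * (\<Sum>k. h (a + (b - a) * q ^ k) * q ^ k)"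

text \<open>
  A kind of \<open>q\<close>-integral together with its parameters: \<open>Restricted n b\<close> on \<open>[b q\<^sup>n, b]\<close>,
  \<open>FromZero b\<close> on \<open>[0, b]\<close> and \<open>Riemann a b\<close> on \<open>[a, b]\<close>.
\<close>

datatype qkind = Restricted nat real | FromZero real | Riemann real real

primrec admissible :: "qkind \<Rightarrow> bool" where
  "admissible (Restricted n b) \<longleftrightarrow> 0 < n \<and> 0 < b"
| "admissible (FromZero b) \<longleftrightarrow> 0 < b"
| "admissible (Riemann a b) \<longleftrightarrow> 0 < a \<and> a < b"

primrec qdomain :: "real \<Rightarrow> qkind \<Rightarrow> real set" where
  "qdomain q (Restricted n b) = {b * q ^ n .. b}"
| "qdomain q (FromZero b) = {0 .. b}"
| "qdomain q (Riemann a b) = {a .. b}"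

primrec qint :: "real \<Rightarrow> qkind \<Rightarrow> (real \<Rightarrow> real) \<Rightarrow> real" where
  "qint q (Restricted n b) h = G_qint q n b h"
| "qint q (FromZero b) h = I_qint q b h"
| "qint q (Riemann a b) h = R_qint q a b h"

primrec qint_exists :: "real \<Rightarrow> qkind \<Rightarrow> (real \<Rightarrow> real) \<Rightarrow> bool" where
  "qint_exists q (Restricted n b) h \<longleftrightarrow> True"
| "qint_exists q (FromZero b) h \<longleftrightarrow> summable (\<lambda>k. h (b * q ^ k) * q ^ k)"
| "qint_exists q (Riemann a b) h \<longleftrightarrow> summable (\<lambda>k. h (a + (b - a) * q ^ k) * q ^ k)"

end

theory Submission
  imports Defs
begin

text \<open>
  All three integrals are finite or infinite sums, with nonnegative weights, of values of the
  integrand at points of the domain (lemma \<open>qint_combination_nonneg\<close>), so it suffices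
  to prove the inequality pointwise.
  Put \<open>t = g x / f x\<close>, a point of \<open>[m, M]\<close>, and divide by \<open>(f x)\<^sup>2\<close>. What remains compares
  \<open>t powr p\<close> with
  \<open>(M powr p - m powr p) / (M - m) * t - m * M * (M powr (p - 1) - m powr (p - 1)) / (M - m)\<close>,
  the chord of the power function between \<open>m\<close> and \<open>M\<close>. The graph lies below the chord when the
  function is convex (\<open>p\<close> outside the open unit interval) and above it when the function is
  concave (\<open>p\<close> inside). The quadratic case is the pointwise inequality
  \<open>0 \<le> (M * f x - g x) * (g x - m * f x)\<close>.
\<close>

lemma suminf_combination_nonneg:
  fixes u v w :: "nat \<Rightarrow> real"
  assumes "summable u" "summable v" "summable w"
    and "\<And>k. 0 \<le> a * u k + b * v k + c * w k"
  shows "0 \<le> a * suminf u + b * suminf v + c * suminf w"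
proof -
  have "(\<lambda>k. a * u k + b * v k + c * w k) sums (a * suminf u + b * suminf v + c * suminf w)"
    by (intro sums_add sums_mult summable_sums assms)
  then show ?thesis
    using sums_le[OF assms(4) sums_zero] by simp
qed

text \<open>
  Linearity and positivity of the integrals in one statement. The coefficients may have any sign
  and only the combination has to be nonnegative; where an integral is a series, convergence allows
  it to be split.
\<close>

lemma qint_combination_nonneg:
  assumes q: "0 < q" "q < 1" and J: "admissible J"
    and ex: "qint_exists q J u" "qint_exists q J v" "qint_exists q J w"
    and nonneg: "\<And>x. x \<in> qdomain q J \<Longrightarrow> 0 \<le> a * u x + b * v x + c * w x"
  shows "0 \<le> a * qint q J u + b * qint q J v + c * qint q J w"
proof (cases J)
  case (Restricted n e)
  have "0 \<le> a * (u (e * q ^ k) * q ^ k) + b * (v (e * q ^ k) * q ^ k) + c * (w (e * q ^ k) * q ^ k)"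
    if "k < n" for k
  proof -
    have "q ^ n \<le> q ^ k" "q ^ k \<le> 1"
      using q that by (auto intro: power_decreasing power_le_one)
    then have "e * q ^ k \<in> qdomain q J"
      using J q by (simp add: Restricted mult_left_le)
    from mult_right_mono[OF nonneg[OF this], of "q ^ k"] show ?thesis
      using q by (simp add: algebra_simps)
  qed
  then have "0 \<le> (\<Sum>k<n. a * (u (e * q ^ k) * q ^ k) + b * (v (e * q ^ k) * q ^ k)
      + c * (w (e * q ^ k) * q ^ k))"
    by (intro sum_nonneg) simp
  from mult_left_mono[OF this, of "e * (1 - q)"] show ?thesis
    using J q by (simp add: Restricted G_qint_def sum.distrib sum_distrib_left algebra_simps)
next
  case (FromZero e)
  have "0 \<le> a * (u (e * q ^ k) * q ^ k) + b * (v (e * q ^ k) * q ^ k) + c * (w (e * q ^ k) * q ^ k)"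
    for k
  proof -
    have "q ^ k \<le> 1"
      using q by (auto intro: power_le_one)
    then have "e * q ^ k \<in> qdomain q J"
      using J q by (simp add: FromZero mult_left_le)
    from mult_right_mono[OF nonneg[OF this], of "q ^ k"] show ?thesis
      using q by (simp add: algebra_simps)
  qed
  note series = suminf_combination_nonneg[OF _ _ _ this]
  have "0 \<le> e * (1 - q)"
    using J q by (simp add: FromZero)
  from mult_nonneg_nonneg[OF this series] show ?thesis
    using ex by (simp add: FromZero I_qint_def distrib_left mult.left_commute)
next
  case (Riemann d e)
  have "0 \<le> a * (u (d + (e - d) * q ^ k) * q ^ k) + b * (v (d + (e - d) * q ^ k) * q ^ k)
      + c * (w (d + (e - d) * q ^ k) * q ^ k)"
    for k
  proof -
    have "q ^ k \<le> 1"
      using q by (auto intro: power_le_one)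
    then have "(e - d) * q ^ k \<le> e - d"
      using J by (simp add: Riemann mult_left_le)
    then have "d + (e - d) * q ^ k \<le> e"
      by linarith
    then have "d + (e - d) * q ^ k \<in> qdomain q J"
      using J q by (simp add: Riemann)
    from mult_right_mono[OF nonneg[OF this], of "q ^ k"] show ?thesis
      using q by (simp add: algebra_simps)
  qed
  note series = suminf_combination_nonneg[OF _ _ _ this]
  have "0 \<le> (e - d) * (1 - q)"
    using J q by (simp add: Riemann)
  from mult_nonneg_nonneg[OF this series] show ?thesis
    using ex by (simp add: Riemann R_qint_def distrib_left mult.left_commute)
qed

lemma DERIV_powr_base_twice:
  fixes x p :: real
  assumes "0 < x"
  shows "((\<lambda>x. x powr p) has_real_derivative p * x powr (p - 1)) (at x)"
    and "((\<lambda>x. p * x powr (p - 1)) has_real_derivative p * (p - 1) * x powr (p - 2)) (at x)"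
  using assms by (auto intro!: derivative_eq_intros simp: algebra_simps)

lemma convex_on_powr:
  fixes p :: real
  assumes "p \<notin> {0<..<1}"
  shows "convex_on {0<..} (\<lambda>x. x powr p)"
proof (rule f''_ge0_imp_convex)
  have "0 \<le> p * (p - 1)"
    using assms by (cases "p \<le> 0") (auto simp: mult_nonpos_nonpos)
  then show "0 \<le> p * (p - 1) * x powr (p - 2)" for x
    by simp
qed (use DERIV_powr_base_twice in auto)

lemma concave_on_powr:
  fixes p :: real
  assumes "p \<in> {0<..<1}"
  shows "concave_on {0<..} (\<lambda>x. x powr p)"
proof (rule f''_le0_imp_concave)
  have "p * (p - 1) \<le> 0"
    using assms by (auto simp: mult_nonneg_nonpos)
  then show "p * (p - 1) * x powr (p - 2) \<le> 0" for x
    by (simp add: mult_nonpos_nonneg)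
qed (use DERIV_powr_base_twice in auto)

lemma powr_chord_eq:
  fixes m M p t :: real
  assumes "0 < m" "m < M"
  shows "(M powr p - m powr p) / (M - m) * (t - m) + m powr p
    = (M powr p - m powr p) / (M - m) * t - m * M * (M powr (p - 1) - m powr (p - 1)) / (M - m)"
proof -
  have "M powr p = M * M powr (p - 1)" "m powr p = m * m powr (p - 1)"
    using assms by (simp_all add: powr_mult_base)
  moreover have "(M - m) * inverse (M - m) = 1"
    using assms by simp
  ultimately show ?thesis
    unfolding divide_inverse by algebra
qed

lemma powr_le_chord:
  fixes m M p t :: real
  assumes "0 < m" "m < M" "t \<in> {m..M}" "p \<notin> {0<..<1}"
  shows "t powr p
    \<le> (M powr p - m powr p) / (M - m) * t - m * M * (M powr (p - 1) - m powr (p - 1)) / (M - m)"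
proof -
  have "convex_on {m..M} (\<lambda>x. x powr p)"
    by (rule convex_on_subset[OF convex_on_powr]) (use assms in auto)
  from convex_onD_Icc'[OF this assms(3)] show ?thesis
    unfolding powr_chord_eq[OF assms(1,2)] .
qed

lemma powr_ge_chord:
  fixes m M p t :: real
  assumes "0 < m" "m < M" "t \<in> {m..M}" "p \<in> {0<..<1}"
  shows "(M powr p - m powr p) / (M - m) * t - m * M * (M powr (p - 1) - m powr (p - 1)) / (M - m)
    \<le> t powr p"
proof -
  have "convex_on {0<..} (\<lambda>x. - (x powr p))"
    using concave_on_powr[OF assms(4)] by (simp add: concave_on_def)
  then have "convex_on {m..M} (\<lambda>x. - (x powr p))"
    by (rule convex_on_subset) (use assms in auto)
  from convex_onD_Icc'[OF this assms(3)]
  have "- (t powr p) \<le> (- (M powr p) - - (m powr p)) / (M - m) * (t - m) + - (m powr p)" .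
  also have "\<dots> = - ((M powr p - m powr p) / (M - m) * (t - m) + m powr p)"
    using assms by (simp add: field_simps)
  finally show ?thesis
    using powr_chord_eq[OF assms(1,2), of p t] by linarith
qed

theorem theorem6p8:
  fixes q m M :: real and J :: qkind and f g :: "real \<Rightarrow> real"
  assumes "0 < q" and "q < 1"
    and "admissible J"
    and "\<forall>x \<in> qdomain q J. 0 < f x"
    and "\<forall>x \<in> qdomain q J. 0 < g x"
    and "0 < m" and "m < M"
    and "\<forall>x \<in> qdomain q J. m \<le> g x / f x \<and> g x / f x \<le> M"
    and "qint_exists q J (\<lambda>x. (f x)\<^sup>2)"
    and "qint_exists q J (\<lambda>x. f x * g x)"
  shows
    "(\<forall>p::real. p \<noteq> 0 \<longrightarrow> qint_exists q J (\<lambda>x. f x powr (2 - p) * g x powr p) \<longrightarrow>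
        (p \<notin> {0<..<1} \<longrightarrow>
           qint q J (\<lambda>x. f x powr (2 - p) * g x powr p)
             + m * M * (M powr (p - 1) - m powr (p - 1)) / (M - m) * qint q J (\<lambda>x. (f x)\<^sup>2)
           \<le> (M powr p - m powr p) / (M - m) * qint q J (\<lambda>x. f x * g x))
      \<and> (p \<in> {0<..<1} \<longrightarrow>
           qint q J (\<lambda>x. f x powr (2 - p) * g x powr p)
             + m * M * (M powr (p - 1) - m powr (p - 1)) / (M - m) * qint q J (\<lambda>x. (f x)\<^sup>2)
           \<ge> (M powr p - m powr p) / (M - m) * qint q J (\<lambda>x. f x * g x)))
     \<and> (qint_exists q J (\<lambda>x. (g x)\<^sup>2) \<longrightarrow>
          qint q J (\<lambda>x. (g x)\<^sup>2) + m * M * qint q J (\<lambda>x. (f x)\<^sup>2)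
          \<le> (M + m) * qint q J (\<lambda>x. f x * g x))"
proof -
  let ?h = "\<lambda>p x. f x powr (2 - p) * g x powr p"
  let ?A = "\<lambda>p. m * M * (M powr (p - 1) - m powr (p - 1)) / (M - m)"
  let ?B = "\<lambda>p. (M powr p - m powr p) / (M - m)"
  have f: "0 < f x" and g: "0 < g x" and t: "g x / f x \<in> {m..M}" if "x \<in> qdomain q J" for x
    using assms that by auto
  note J_nonneg = qint_combination_nonneg[OF assms(1-3) _ assms(9,10)]
  have h: "?h p x = (f x)\<^sup>2 * (g x / f x) powr p" if "x \<in> qdomain q J" for p x
    using f[OF that] g[OF that] by (simp add: powr_divide powr_diff powr_numeral)
  have fg: "f x * g x = (f x)\<^sup>2 * (g x / f x)" if "x \<in> qdomain q J" for x
    using f[OF that] by (simp add: power2_eq_square)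
  have convex_case: "qint q J (?h p) + ?A p * qint q J (\<lambda>x. (f x)\<^sup>2) \<le> ?B p * qint q J (\<lambda>x. f x * g x)"
    if ex: "qint_exists q J (?h p)" and p: "p \<notin> {0<..<1}" for p
  proof -
    have "0 \<le> (-1) * ?h p x + (- ?A p) * (f x)\<^sup>2 + ?B p * (f x * g x)" if x: "x \<in> qdomain q J" for x
    proof -
      have "0 \<le> (f x)\<^sup>2 * (?B p * (g x / f x) - ?A p - (g x / f x) powr p)"
        using powr_le_chord[OF assms(6,7) t[OF x] p] by simp
      also have "\<dots> = (-1) * ?h p x + (- ?A p) * (f x)\<^sup>2 + ?B p * (f x * g x)"
        unfolding h[OF x] fg[OF x] by algebra
      finally show ?thesis .
    qed
    from J_nonneg[OF ex this] show ?thesis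
      by simp
  qed
  have concave_case: "?B p * qint q J (\<lambda>x. f x * g x) \<le> qint q J (?h p) + ?A p * qint q J (\<lambda>x. (f x)\<^sup>2)"
    if ex: "qint_exists q J (?h p)" and p: "p \<in> {0<..<1}" for p
  proof -
    have "0 \<le> 1 * ?h p x + ?A p * (f x)\<^sup>2 + (- ?B p) * (f x * g x)" if x: "x \<in> qdomain q J" for x
    proof -
      have "0 \<le> (f x)\<^sup>2 * ((g x / f x) powr p - (?B p * (g x / f x) - ?A p))"
        using powr_ge_chord[OF assms(6,7) t[OF x] p] by simp
      also have "\<dots> = 1 * ?h p x + ?A p * (f x)\<^sup>2 + (- ?B p) * (f x * g x)"
        unfolding h[OF x] fg[OF x] by algebra
      finally show ?thesis .
    qed
    from J_nonneg[OF ex this] show ?thesis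
      by simp
  qed
  have square_case: "qint q J (\<lambda>x. (g x)\<^sup>2) + m * M * qint q J (\<lambda>x. (f x)\<^sup>2)
      \<le> (M + m) * qint q J (\<lambda>x. f x * g x)"
    if ex: "qint_exists q J (\<lambda>x. (g x)\<^sup>2)"
  proof -
    have "0 \<le> (-1) * (g x)\<^sup>2 + (- (m * M)) * (f x)\<^sup>2 + (M + m) * (f x * g x)"
      if x: "x \<in> qdomain q J" for x
    proof -
      have "m * f x \<le> g x" "g x \<le> M * f x"
        using t[OF x] f[OF x] by (simp_all add: field_simps)
      then have "0 \<le> (M * f x - g x) * (g x - m * f x)"
        by simp
      also have "\<dots> = (-1) * (g x)\<^sup>2 + (- (m * M)) * (f x)\<^sup>2 + (M + m) * (f x * g x)"
        by algebra
      finally show ?thesis .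
    qed
    from J_nonneg[OF ex this] show ?thesis
      by simp
  qed
  show ?thesis
    using convex_case concave_case square_case by blast
qed

end
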